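(* Let $B$ be a finite bouquet of circles, let $J$ be a based graph, and let $J\to B$ be an immersion of graphs. Let $J_1\subseteq J_2\subseteq\cdots$ be an increasing sequence of finite connected based subgraphs of $J$ with $J=\bigcup_{i=1}^\infty J_i$. Let $H=\pi_1 J$ and, for each $i$, let $H_i=\pi_1 J_i$, and regard these as subgroups of $F=\pi_1 B$. Then $$\lim_{i\to\infty}\omega_F(H_i)=\omega_F(H).$$
   Context: Graphs may have loops and multiple edges and may be infinite. A finite bouquet of circles $B$ is a graph with one vertex and finitely many directed edges (loops) $1,\dots,r$; its fundamental group $F=\pi_1 B$ (based at its vertex) is free with basis $S$ corresponding to the directed loops. An immersion $J\to B$ is a map of directed graphs (vertices to vertices, directed edges to directed edges) that is locally injective: at each vertex of $J$, no two distinct outgoing edges have the same image in $B$, and no two distinct incoming edges have the same image in $B$ (a loop counts as both outgoing and incoming at its vertex). A basepoint of $J$ is fixed; a based subgraph is a subgraph containing this basepoint, with that basepoint; all fundamental groups are taken at the basepoint. An immersion induces an injection on $\pi_1$, so $\pi_1 J$ and $\pi_1 J_i$ are identified with their images in $F$. For a subgroup $K\le F$, its growth rate in $F$ is $\omega_F(K)=\limsup_{n\to\infty}\big(\#\{g\in K:\|g\|_S=n\}\big)^{1/n}$, where $\|g\|_S$ is the word length with respect to the basis $S$. *)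

theory Defs
  imports
    Complex_Main
    "HOL-Library.Extended_Real"
    "HOL-Library.Liminf_Limsup"
    "HOL-Algebra.Group"
    "Graph_Theory.Digraph"
    "Graph_Theory.Digraph_Component"
begin

section \<open>Graph maps, immersions and bouquets\<close>

text \<open>
  A graph with loops and multiple edges, possibly infinite, is a \<^locale>\<open>wf_digraph\<close>.
\<close>

definition bouquet :: "('w, 'd) pre_digraph \<Rightarrow> 'w \<Rightarrow> bool" where
  "bouquet B b \<longleftrightarrow> fin_digraph B \<and> verts B = {b}"

definition graph_map ::
  "('v, 'e) pre_digraph \<Rightarrow> ('w, 'd) pre_digraph \<Rightarrow> ('v \<Rightarrow> 'w) \<Rightarrow> ('e \<Rightarrow> 'd) \<Rightarrow> bool" where
  "graph_map J B fv fe \<longleftrightarrow>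
     wf_digraph J \<and> wf_digraph B \<and>
     (\<forall>v \<in> verts J. fv v \<in> verts B) \<and>
     (\<forall>e \<in> arcs J. fe e \<in> arcs B \<and>
        tail B (fe e) = fv (tail J e) \<and> head B (fe e) = fv (head J e))"

definition immersion ::
  "('v, 'e) pre_digraph \<Rightarrow> ('w, 'd) pre_digraph \<Rightarrow> ('v \<Rightarrow> 'w) \<Rightarrow> ('e \<Rightarrow> 'd) \<Rightarrow> bool" where
  "immersion J B fv fe \<longleftrightarrow>
     graph_map J B fv fe \<and>
     (\<forall>v \<in> verts J. inj_on fe (out_arcs J v) \<and> inj_on fe (in_arcs J v))"

section \<open>The fundamental group of a graph\<close>

text \<open>
  Edge paths may traverse a directed edge in either direction: \<open>(e, True)\<close> runs along
  \<open>e\<close> from tail to head, and \<open>(e, False)\<close> runs from head to tail.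
\<close>

type_synonym 'e oriented_edge = "'e \<times> bool"

definition origin :: "('v, 'e) pre_digraph \<Rightarrow> 'e oriented_edge \<Rightarrow> 'v" where
  "origin G x = (if snd x then tail G (fst x) else head G (fst x))"

definition terminus :: "('v, 'e) pre_digraph \<Rightarrow> 'e oriented_edge \<Rightarrow> 'v" where
  "terminus G x = (if snd x then head G (fst x) else tail G (fst x))"

definition reverse_edge :: "'e oriented_edge \<Rightarrow> 'e oriented_edge" where
  "reverse_edge x = (fst x, \<not> snd x)"

fun edge_path :: "('v, 'e) pre_digraph \<Rightarrow> 'v \<Rightarrow> 'e oriented_edge list \<Rightarrow> 'v \<Rightarrow> bool" where
  "edge_path G u [] v \<longleftrightarrow> u \<in> verts G \<and> u = v"
| "edge_path G u (x # p) v \<longleftrightarrow>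
     fst x \<in> arcs G \<and> origin G x = u \<and> edge_path G (terminus G x) p v"

definition closed_paths :: "('v, 'e) pre_digraph \<Rightarrow> 'v \<Rightarrow> 'e oriented_edge list set" where
  "closed_paths G v = {p. edge_path G v p v}"

inductive homotopic ::
  "('v, 'e) pre_digraph \<Rightarrow> 'v \<Rightarrow> 'e oriented_edge list \<Rightarrow> 'e oriented_edge list \<Rightarrow> bool"
  for G v where
  homotopic_refl: "p \<in> closed_paths G v \<Longrightarrow> homotopic G v p p"
| homotopic_backtrack:
    "p @ [x, reverse_edge x] @ q \<in> closed_paths G v \<Longrightarrow> p @ q \<in> closed_paths G v \<Longrightarrow>
     homotopic G v (p @ [x, reverse_edge x] @ q) (p @ q)"
| homotopic_sym: "homotopic G v p q \<Longrightarrow> homotopic G v q p"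
| homotopic_trans: "homotopic G v p q \<Longrightarrow> homotopic G v q r \<Longrightarrow> homotopic G v p r"

definition homotopy :: "('v, 'e) pre_digraph \<Rightarrow> 'v \<Rightarrow> 'e oriented_edge list rel" where
  "homotopy G v = {(p, q). homotopic G v p q}"

definition fundamental_group ::
  "('v, 'e) pre_digraph \<Rightarrow> 'v \<Rightarrow> 'e oriented_edge list set monoid" where
  "fundamental_group G v =
     \<lparr> carrier = closed_paths G v // homotopy G v,
       monoid.mult = (\<lambda>X Y. homotopy G v `` {p @ q | p q. p \<in> X \<and> q \<in> Y}),
       monoid.one = homotopy G v `` {[]} \<rparr>"

definition map_path :: "('e \<Rightarrow> 'd) \<Rightarrow> 'e oriented_edge list \<Rightarrow> 'd oriented_edge list" where
  "map_path fe = map (\<lambda>(e, s). (fe e, s))"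

text \<open>
  The homomorphism that a graph map with edge part \<open>fe\<close> induces on fundamental groups,
  the target being \<open>\<pi>\<^sub>1(B, b)\<close>.
\<close>

definition induced_map ::
  "('w, 'd) pre_digraph \<Rightarrow> 'w \<Rightarrow> ('e \<Rightarrow> 'd) \<Rightarrow>
   'e oriented_edge list set \<Rightarrow> 'd oriented_edge list set" where
  "induced_map B b fe X = homotopy B b `` (map_path fe ` X)"

definition pi1_image ::
  "('v, 'e) pre_digraph \<Rightarrow> 'v \<Rightarrow> ('w, 'd) pre_digraph \<Rightarrow> 'w \<Rightarrow> ('e \<Rightarrow> 'd) \<Rightarrow>
   'd oriented_edge list set set" where
  "pi1_image J v B b fe = induced_map B b fe ` carrier (fundamental_group J v)"

definition loop_basis :: "('w, 'd) pre_digraph \<Rightarrow> 'w \<Rightarrow> 'd oriented_edge list set set" where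
  "loop_basis B b = {homotopy B b `` {[(e, True)]} | e. e \<in> arcs B}"

section \<open>Word length and growth rate\<close>

definition word_length :: "('g, 'm) monoid_scheme \<Rightarrow> 'g set \<Rightarrow> 'g \<Rightarrow> nat" where
  "word_length F S g =
     (LEAST n. \<exists>ws. length ws = n \<and> set ws \<subseteq> S \<union> m_inv F ` S \<and> foldr (monoid.mult F) ws \<one>\<^bsub>F\<^esub> = g)"

text \<open>
  The limit superior is taken in \<^typ>\<open>ereal\<close>, so that it exists unconditionally.  For finite \<open>S\<close>
  generating \<open>F\<close> the spheres are finite, and the value is at most \<open>2 * card S\<close>.
\<close>

definition growth_rate :: "('g, 'm) monoid_scheme \<Rightarrow> 'g set \<Rightarrow> 'g set \<Rightarrow> ereal" where
  "growth_rate F S K =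
     limsup (\<lambda>n. ereal (root n (real (card {g \<in> K. word_length F S g = n}))))"

section \<open>Well-definedness of the fundamental group and of induced maps\<close>

lemma edge_path_verts:
  "wf_digraph G \<Longrightarrow> edge_path G u p v \<Longrightarrow> u \<in> verts G \<and> v \<in> verts G"
  by (induction p arbitrary: u)
     (auto simp: origin_def wf_digraph.tail_in_verts wf_digraph.head_in_verts)

lemma edge_path_append:
  "wf_digraph G \<Longrightarrow>
   edge_path G u (p @ q) w \<longleftrightarrow> (\<exists>v. edge_path G u p v \<and> edge_path G v q w)"
  by (induction p arbitrary: u) (auto dest: edge_path_verts)

lemma closed_paths_append:
  "wf_digraph G \<Longrightarrow> p \<in> closed_paths G v \<Longrightarrow> q \<in> closed_paths G v \<Longrightarrow>
   p @ q \<in> closed_paths G v"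
  by (auto simp: closed_paths_def edge_path_append)

lemma homotopic_closed:
  "homotopic G v p q \<Longrightarrow> p \<in> closed_paths G v \<and> q \<in> closed_paths G v"
  by (induction rule: homotopic.induct) auto

lemma equiv_homotopy: "equiv (closed_paths G v) (homotopy G v)"
proof (rule equivI)
  show "homotopy G v \<subseteq> closed_paths G v \<times> closed_paths G v"
    by (auto simp: homotopy_def dest: homotopic_closed)
  show "refl_on (closed_paths G v) (homotopy G v)"
    by (auto simp: homotopy_def refl_on_def intro: homotopic_refl)
  show "sym (homotopy G v)"
    using homotopic_sym[of G v] by (auto simp: homotopy_def intro: symI)
  show "trans (homotopy G v)"
    using homotopic_trans[of G v] unfolding homotopy_def trans_def by blast
qed

lemma homotopic_append_right:
  assumes "wf_digraph G" "homotopic G v p p'" "q \<in> closed_paths G v"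
  shows "homotopic G v (p @ q) (p' @ q)"
  using assms(2)
proof (induction rule: homotopic.induct)
  case (homotopic_backtrack p x r)
  have "(p @ [x, reverse_edge x] @ r) @ q \<in> closed_paths G v" "(p @ r) @ q \<in> closed_paths G v"
    using homotopic_backtrack assms by (simp_all only: closed_paths_append)
  then show ?case
    using homotopic.homotopic_backtrack[of p x "r @ q" G v] by simp
next
  case (homotopic_refl p)
  then show ?case using assms by (intro homotopic.homotopic_refl closed_paths_append)
next
  case (homotopic_sym p r)
  show ?case by (rule homotopic.homotopic_sym[OF homotopic_sym.IH])
next
  case (homotopic_trans p r s)
  show ?case by (rule homotopic.homotopic_trans[OF homotopic_trans.IH])
qed

lemma homotopic_append_left:
  assumes "wf_digraph G" "homotopic G v p p'" "q \<in> closed_paths G v"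
  shows "homotopic G v (q @ p) (q @ p')"
  using assms(2)
proof (induction rule: homotopic.induct)
  case (homotopic_backtrack p x r)
  have "q @ (p @ [x, reverse_edge x] @ r) \<in> closed_paths G v" "q @ (p @ r) \<in> closed_paths G v"
    using homotopic_backtrack assms by (simp_all only: closed_paths_append)
  then show ?case
    using homotopic.homotopic_backtrack[of "q @ p" x r G v] by simp
next
  case (homotopic_refl p)
  then show ?case using assms by (intro homotopic.homotopic_refl closed_paths_append)
next
  case (homotopic_sym p r)
  show ?case by (rule homotopic.homotopic_sym[OF homotopic_sym.IH])
next
  case (homotopic_trans p r s)
  show ?case by (rule homotopic.homotopic_trans[OF homotopic_trans.IH])
qed

lemma homotopic_append:
  assumes "wf_digraph G" "homotopic G v p p'" "homotopic G v q q'"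
  shows "homotopic G v (p @ q) (p' @ q')"
proof (rule homotopic_trans)
  show "homotopic G v (p @ q) (p' @ q)"
    using assms homotopic_closed[OF assms(3)] by (simp add: homotopic_append_right)
  show "homotopic G v (p' @ q) (p' @ q')"
    using assms homotopic_closed[OF assms(2)] by (simp add: homotopic_append_left)
qed

lemma homotopy_class_eq_iff:
  "p \<in> closed_paths G v \<Longrightarrow> q \<in> closed_paths G v \<Longrightarrow>
   homotopy G v `` {p} = homotopy G v `` {q} \<longleftrightarrow> homotopic G v p q"
  using eq_equiv_class_iff[OF equiv_homotopy, of p G v q] by (simp add: homotopy_def)

lemma mult_fundamental_group:
  assumes "wf_digraph G" "p \<in> closed_paths G v" "q \<in> closed_paths G v"
  shows "homotopy G v `` {p} \<otimes>\<^bsub>fundamental_group G v\<^esub> homotopy G v `` {q}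
    = homotopy G v `` {p @ q}"
proof -
  have "homotopic G v (p @ q) r"
    if "homotopic G v p p'" "homotopic G v q q'" "homotopic G v (p' @ q') r" for p' q' r
    using that homotopic_append[OF assms(1)] homotopic_trans by metis
  moreover note homotopic_refl[OF assms(2)] homotopic_refl[OF assms(3)]
  ultimately show ?thesis
    unfolding fundamental_group_def homotopy_def by (simp add: set_eq_iff Image_def) blast
qed

definition reverse_path :: "'e oriented_edge list \<Rightarrow> 'e oriented_edge list" where
  "reverse_path p = rev (map reverse_edge p)"

lemma edge_path_reverse:
  "wf_digraph G \<Longrightarrow> edge_path G u p v \<Longrightarrow> edge_path G v (reverse_path p) u"
  by (induction p arbitrary: u)
     (auto simp: reverse_path_def edge_path_append reverse_edge_def origin_def terminus_def
       wf_digraph.tail_in_verts wf_digraph.head_in_verts)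

lemma homotopic_reverse:
  assumes "wf_digraph G" "edge_path G v p w"
  shows "homotopic G v (p @ reverse_path p) []"
  using assms(2)
proof (induction p arbitrary: w rule: rev_induct)
  case Nil
  then show ?case by (auto simp: reverse_path_def closed_paths_def intro: homotopic_refl)
next
  case (snoc x p)
  then obtain u where u: "edge_path G v p u" by (auto simp: edge_path_append[OF assms(1)])
  have "edge_path G v ((p @ [x]) @ reverse_path (p @ [x])) v"
    and "edge_path G v (p @ reverse_path p) v"
    using snoc.prems u edge_path_reverse[OF assms(1)] edge_path_append[OF assms(1)] by blast+
  then have "homotopic G v ((p @ [x]) @ reverse_path (p @ [x])) (p @ reverse_path p)"
    using homotopic_backtrack[of p x "reverse_path p" G v]
    by (simp add: closed_paths_def reverse_path_def)
  then show ?case using snoc.IH[OF u] homotopic_trans by metis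
qed

lemma reverse_path_reverse_path: "reverse_path (reverse_path p) = p"
  by (simp add: reverse_path_def rev_map o_def reverse_edge_def)

lemma group_fundamental_group:
  assumes G: "wf_digraph G" and v: "v \<in> verts G"
  shows "group (fundamental_group G v)"
proof -
  let ?P = "fundamental_group G v" and ?c = "\<lambda>p. homotopy G v `` {p}"
  have carr: "carrier ?P = ?c ` closed_paths G v"
    by (auto simp: fundamental_group_def quotient_def)
  have one: "\<one>\<^bsub>?P\<^esub> = ?c []" by (simp add: fundamental_group_def)
  have nil: "[] \<in> closed_paths G v" using v by (simp add: closed_paths_def)
  note m = mult_fundamental_group[OF G] closed_paths_append[OF G]
  show ?thesis
  proof (rule groupI)
    fix x assume "x \<in> carrier ?P"
    then obtain p where p: "p \<in> closed_paths G v" "x = ?c p" by (auto simp: carr)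
    have r: "reverse_path p \<in> closed_paths G v"
      using p edge_path_reverse[OF G] by (auto simp: closed_paths_def)
    have "homotopic G v (reverse_path p @ p) []"
      using homotopic_reverse[OF G, of v "reverse_path p" v] r
      by (simp add: closed_paths_def reverse_path_reverse_path)
    then have "?c (reverse_path p) \<otimes>\<^bsub>?P\<^esub> x = \<one>\<^bsub>?P\<^esub>"
      using p r nil homotopy_class_eq_iff[of "reverse_path p @ p" G v "[]"] by (simp add: m one)
    then show "\<exists>y \<in> carrier ?P. y \<otimes>\<^bsub>?P\<^esub> x = \<one>\<^bsub>?P\<^esub>" using r by (auto simp: carr)
  qed (use nil in \<open>auto simp: carr one m\<close>)
qed

lemma map_path_append: "map_path fe (p @ q) = map_path fe p @ map_path fe q"
  by (simp add: map_path_def)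

lemma map_path_closed:
  assumes "graph_map J B fv fe" "edge_path J u p w"
  shows "edge_path B (fv u) (map_path fe p) (fv w)"
  using assms(2)
  by (induction p arbitrary: u)
     (use assms(1) in \<open>auto simp: graph_map_def map_path_def origin_def terminus_def split: if_splits\<close>)

lemma map_path_homotopic:
  assumes "graph_map J B fv fe" "homotopic J v p q"
  shows "homotopic B (fv v) (map_path fe p) (map_path fe q)"
  using assms(2)
proof (induction rule: homotopic.induct)
  case (homotopic_backtrack p x q)
  then have "map_path fe (p @ [x, reverse_edge x] @ q) \<in> closed_paths B (fv v)"
    "map_path fe (p @ q) \<in> closed_paths B (fv v)"
    using map_path_closed[OF assms(1)] unfolding closed_paths_def by blast+
  then show ?case
    using homotopic.homotopic_backtrack[of "map_path fe p" "(fe (fst x), snd x)" "map_path fe q"]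
    by (simp add: map_path_def reverse_edge_def case_prod_unfold)
next
  case (homotopic_refl p)
  then show ?case
    using map_path_closed[OF assms(1)]
    by (intro homotopic.homotopic_refl) (simp add: closed_paths_def)
next
  case (homotopic_sym p r)
  show ?case by (rule homotopic.homotopic_sym[OF homotopic_sym.IH])
next
  case (homotopic_trans p r s)
  show ?case by (rule homotopic.homotopic_trans[OF homotopic_trans.IH])
qed

lemma induced_map_class:
  assumes "graph_map J B fv fe" "p \<in> closed_paths J v"
  shows "induced_map B (fv v) fe (homotopy J v `` {p}) = homotopy B (fv v) `` {map_path fe p}"
proof -
  have "homotopic B (fv v) (map_path fe p) r"
    if "homotopic J v p q" "homotopic B (fv v) (map_path fe q) r" for q r
    using that map_path_homotopic[OF assms(1)] homotopic_trans by metis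
  moreover have "homotopic J v p p" by (rule homotopic_refl[OF assms(2)])
  ultimately show ?thesis
    unfolding induced_map_def homotopy_def by (simp add: set_eq_iff Image_def) blast
qed

lemma induced_map_hom:
  assumes "graph_map J B fv fe"
  shows "induced_map B (fv v) fe \<in> hom (fundamental_group J v) (fundamental_group B (fv v))"
proof -
  have wf: "wf_digraph J" "wf_digraph B" using assms by (auto simp: graph_map_def)
  have mp: "map_path fe p \<in> closed_paths B (fv v)" if "p \<in> closed_paths J v" for p
    using that map_path_closed[OF assms] by (auto simp: closed_paths_def)
  have carr: "carrier (fundamental_group G u) = (\<lambda>p. homotopy G u `` {p}) ` closed_paths G u"
    for G :: "('x, 'y) pre_digraph" and u
    by (auto simp: fundamental_group_def quotient_def)
  show ?thesis
    by (rule homI)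
       (auto simp: carr mp induced_map_class[OF assms] mult_fundamental_group wf
         closed_paths_append map_path_append)
qed

end

theory Submission
  imports Defs
begin

text \<open>
  Identify \<open>F\<close> with the reduced words over the edges of \<open>B\<close>, so that \<open>H\<close> is the increasing
  union of the subgroups \<open>H\<^sub>i\<close>. After conjugation, the nontrivial elements of \<open>H\<close> have no
  common first letter. By the pigeonhole principle, a fixed fraction of the elements of \<open>H\<close> of
  length \<open>n\<close> share the first letter \<open>x\<close> and the last letter \<open>y\<close>, and some \<open>r \<in> H\<close>, of length
  bounded independently of \<open>n\<close>, makes all products \<open>p\<^sub>1 r p\<^sub>2 r \<dots> r p\<^sub>j\<close> of such elements reduced.
  All these products lie in \<open>H\<^sub>i\<close> as soon as the finitely many factors do, so the growth rate of \<open>H\<^sub>i\<close> is almost the \<open>n\<close>-th root of the number of elements of \<open>H\<close> of length \<open>n\<close>.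
\<close>

section \<open>Reduced words\<close>

definition reduced :: "'a oriented_edge list \<Rightarrow> bool" where
  "reduced = successively (\<lambda>x y. y \<noteq> reverse_edge x)"

text \<open>Left multiplication by a letter. On reduced words \<open>push x\<close> and
  \<open>push (reverse_edge x)\<close> are mutually inverse, so the free group acts on reduced
  words; this yields the uniqueness of reduced forms without a confluence argument.\<close>

fun push :: "'a oriented_edge \<Rightarrow> 'a oriented_edge list \<Rightarrow> 'a oriented_edge list" where
  "push x [] = [x]"
| "push x (y # p) = (if y = reverse_edge x then p else x # y # p)"

definition reduce :: "'a oriented_edge list \<Rightarrow> 'a oriented_edge list" where
  "reduce p = foldr push p []"

lemma reverse_edge_reverse_edge [simp]: "reverse_edge (reverse_edge x) = x"
  by (simp add: reverse_edge_def)

lemma reverse_edge_neq [simp]: "reverse_edge x \<noteq> x" "x \<noteq> reverse_edge x"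
  by (auto simp: reverse_edge_def prod_eq_iff)

lemma reverse_edge_eq_iff [simp]: "reverse_edge x = reverse_edge y \<longleftrightarrow> x = y"
  by (metis reverse_edge_reverse_edge)

lemma reverse_path_simps [simp]:
  "reverse_path [] = []"
  "reverse_path (x # p) = reverse_path p @ [reverse_edge x]"
  "reverse_path (p @ q) = reverse_path q @ reverse_path p"
  "reverse_path p = [] \<longleftrightarrow> p = []"
  "length (reverse_path p) = length p"
  "reverse_path (reverse_path p) = p"
  by (simp_all add: reverse_path_def reverse_path_reverse_path[unfolded reverse_path_def])

lemma hd_reverse_path: "p \<noteq> [] \<Longrightarrow> hd (reverse_path p) = reverse_edge (last p)"
  by (simp add: reverse_path_def hd_rev last_map)

lemma last_reverse_path: "p \<noteq> [] \<Longrightarrow> last (reverse_path p) = reverse_edge (hd p)"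
  by (simp add: reverse_path_def last_rev hd_map)

lemma reduced_simps [simp]:
  "reduced []"
  "reduced [x]"
  "reduced (x # y # p) \<longleftrightarrow> y \<noteq> reverse_edge x \<and> reduced (y # p)"
  by (simp_all add: reduced_def)

lemma reduced_append:
  "reduced (p @ q) \<longleftrightarrow>
     reduced p \<and> reduced q \<and> (p \<noteq> [] \<and> q \<noteq> [] \<longrightarrow> hd q \<noteq> reverse_edge (last p))"
  unfolding reduced_def by (auto simp: successively_append_iff)

lemma reduced_Cons: "reduced (x # p) \<longleftrightarrow> reduced p \<and> (p \<noteq> [] \<longrightarrow> hd p \<noteq> reverse_edge x)"
  using reduced_append[of "[x]" p] by auto

lemma reduced_reverse_path [simp]: "reduced (reverse_path p) \<longleftrightarrow> reduced p"
proof -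
  have "reduced (reverse_path p)" if "reduced p" for p :: "'a oriented_edge list"
    using that by (induction p) (auto simp: reduced_append reduced_Cons last_reverse_path)
  from this[of p] this[of "reverse_path p"] show ?thesis by auto
qed

lemma reduced_push: "reduced p \<Longrightarrow> reduced (push x p)"
  by (cases p) (auto simp: reduced_Cons)

lemma push_push [simp]: "reduced p \<Longrightarrow> push x (push (reverse_edge x) p) = p"
  by (cases p rule: remdups_adj.cases) auto

lemma push_push' [simp]: "reduced p \<Longrightarrow> push (reverse_edge x) (push x p) = p"
  using push_push[of p "reverse_edge x"] by simp

lemma reduce_Nil [simp]: "reduce [] = []"
  by (simp add: reduce_def)

lemma reduce_Cons: "reduce (x # p) = push x (reduce p)"
  by (simp add: reduce_def)

lemma reduced_reduce [simp]: "reduced (reduce p)"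
  by (induction p) (auto simp: reduce_Cons reduced_push)

lemma reduce_reduced: "reduced p \<Longrightarrow> reduce p = p"
  by (induction p rule: induct_list012) (auto simp: reduce_Cons)

lemma reduce_reduce [simp]: "reduce (reduce p) = reduce p"
  by (simp add: reduce_reduced)

lemma reduce_append: "reduce (p @ q) = foldr push p (reduce q)"
  by (simp add: reduce_def)

lemma reduce_reduce_right [simp]: "reduce (p @ reduce q) = reduce (p @ q)"
  by (simp add: reduce_append reduce_reduced)

lemma reduced_foldr_push: "reduced r \<Longrightarrow> reduced (foldr push p r)"
  by (induction p) (auto simp: reduced_push)

lemma foldr_push_push: "reduced r \<Longrightarrow> foldr push (push x p) r = push x (foldr push p r)"
  by (cases p) (auto simp: reduced_foldr_push)

text \<open>A word and its reduction act alike on reduced words, because an inverse pair of letters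
  acts trivially.\<close>

lemma reduce_reduce_left [simp]: "reduce (reduce p @ q) = reduce (p @ q)"
proof -
  have "foldr push (reduce p) r = foldr push p r" if "reduced r" for r
    using that by (induction p) (auto simp: reduce_Cons foldr_push_push)
  then show ?thesis by (simp add: reduce_append)
qed

lemma reduce_cancel [simp]:
  "reduce (p @ x # reverse_edge x # q) = reduce (p @ q)"
  "reduce (p @ reverse_edge x # x # q) = reduce (p @ q)"
  by (simp_all add: reduce_append reduce_Cons)

section \<open>Cancellation in products of reduced words\<close>

lemma reduce_cancel_path:
  "reduce (p @ r @ reverse_path r @ q) = reduce (p @ q)"
proof (induction r arbitrary: p q)
  case (Cons x r)
  then show ?case using Cons.IH[of "p @ [x]" "reverse_edge x # q"] by simp
qed simp

lemma length_reduce_le: "length (reduce p) \<le> length p"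
proof (induction p)
  case (Cons x p)
  then show ?case by (cases "reduce p") (auto simp: reduce_Cons)
qed simp

text \<open>Multiplying by \<open>reverse_path p\<close> from the left recovers either word.\<close>

lemma reduce_left_cancel:
  assumes "reduced a" "reduced c" "reduce (p @ a) = reduce (p @ c)"
  shows "a = c"
proof -
  have "reduce u = reduce (reverse_path p @ reduce (p @ u))" for u
    using reduce_cancel_path[of "[]" "reverse_path p" u] by simp
  then show ?thesis using assms by (metis reduce_reduced)
qed

lemma common_suffix:
  obtains p' q' s where "p = p' @ s" "q = q' @ s" "p' = [] \<or> q' = [] \<or> last p' \<noteq> last q'"
proof (induction p arbitrary: q thesis rule: rev_induct)
  case Nil
  then show ?case by (metis append_Nil append_Nil2)
next
  case (snoc x p)
  show ?case
  proof (cases "q \<noteq> [] \<and> last q = x")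
    case True
    then obtain q0 where q: "q = q0 @ [x]" by (metis append_butlast_last_id)
    obtain p' q' s where "p = p' @ s" "q0 = q' @ s" "p' = [] \<or> q' = [] \<or> last p' \<noteq> last q'"
      using snoc.IH by blast
    then show ?thesis using snoc.prems[of p' "s @ [x]" q'] q by auto
  next
    case False
    then show ?thesis using snoc.prems[of "p @ [x]" "[]" q] by auto
  qed
qed

text \<open>Only the common suffix \<open>s\<close> cancels: unless \<open>p\<close> or
  \<open>q\<close> is empty, their different last letters prevent cancellation at the new
  junction.\<close>

lemma reduce_quotient:
  assumes "reduced (p @ s)" "reduced (q @ s)" "p = [] \<or> q = [] \<or> last p \<noteq> last q"
  shows "reduce ((p @ s) @ reverse_path (q @ s)) = p @ reverse_path q"
proof -
  have "reduced (p @ reverse_path q)"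
    using assms by (auto simp: reduced_append hd_reverse_path)
  then show ?thesis
    using reduce_cancel_path[of p s "reverse_path q"] by (simp add: reduce_reduced)
qed

text \<open>Each letter of \<open>q\<close> cancels at most one letter of \<open>p\<close>, so the
  first letter of the longer word survives. The letters of \<open>q\<close> are moved one at a time
  to the end of \<open>p\<close>, where they cancel or lengthen it.\<close>

lemma hd_reduce_append:
  assumes "reduced p" "length q < length p"
  shows "reduce (p @ q) \<noteq> [] \<and> hd (reduce (p @ q)) = hd p"
  using assms
proof (induction q arbitrary: p)
  case Nil
  then show ?case by (auto simp: reduce_reduced)
next
  case (Cons x q)
  then obtain p0 y where p: "p = p0 @ [y]" by (cases p rule: rev_cases) auto
  then have p0: "reduced p0" "p0 \<noteq> []" "length q < length p0"
    using Cons.prems by (auto simp: reduced_append)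
  show ?case
  proof (cases "x = reverse_edge y")
    case True
    then show ?thesis using Cons.IH[of p0] p0 p by simp
  next
    case False
    then have "reduced (p @ [x])" using Cons.prems p by (auto simp: reduced_append)
    then show ?thesis using Cons.IH[of "p @ [x]"] Cons.prems p0 p by simp
  qed
qed

section \<open>Subgroups of a free group as sets of reduced words\<close>

definition word_group :: "'a oriented_edge list set \<Rightarrow> bool" where
  "word_group K \<longleftrightarrow> [] \<in> K \<and> (\<forall>p \<in> K. reduced p \<and> reverse_path p \<in> K) \<and>
     (\<forall>p \<in> K. \<forall>q \<in> K. reduce (p @ q) \<in> K)"

lemma word_groupD:
  assumes "word_group K"
  shows "[] \<in> K" "p \<in> K \<Longrightarrow> reduced p" "p \<in> K \<Longrightarrow> reverse_path p \<in> K"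
    "p \<in> K \<Longrightarrow> q \<in> K \<Longrightarrow> reduce (p @ q) \<in> K"
    "p \<in> K \<Longrightarrow> q \<in> K \<Longrightarrow> reduced (p @ q) \<Longrightarrow> p @ q \<in> K"
  using assms reduce_reduced unfolding word_group_def by fastforce+

text \<open>
  Suppose there is no such \<open>r\<close>. Then every element of \<open>K\<close> that does not start with \<open>x\<close> ends with
  \<open>reverse_edge x\<close>. Of two such elements one is a suffix of the other, because \<open>b * b'\<inverse>\<close>
  would serve as \<open>r\<close> otherwise; hence, by the Euclidean algorithm, any two of them commute.
  Multiplying \<open>a\<close> from the left by a long such element gives such an element again, and this
  contradicts the form of \<open>a\<close>.
\<close>

lemma bridge_exists:
  assumes K: "word_group K"
    and a: "a \<in> K" "a \<noteq> []" "hd a = x" "last a = reverse_edge x"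
    and q: "q \<in> K" "q \<noteq> []" "hd q \<noteq> x"
  obtains r where "r \<in> K" "r \<noteq> []" "hd r \<noteq> x" "last r \<noteq> reverse_edge x"
proof (rule ccontr)
  assume "\<not> thesis"
  with that have no: "last r = reverse_edge x" if "r \<in> K" "r \<noteq> []" "hd r \<noteq> x" for r
    using that by blast
  define Q where "Q = {r \<in> K. r \<noteq> [] \<and> hd r \<noteq> x}"
  note KD = word_groupD[OF K]
  have suffix: "(\<exists>c. c \<in> Q \<and> b = c @ b') \<or> (\<exists>c. c \<in> Q \<and> b' = c @ b) \<or> b = b'"
    if b: "b \<in> Q" "b' \<in> Q" for b b'
  proof -
    obtain p p' s where s: "b = p @ s" "b' = p' @ s" "p = [] \<or> p' = [] \<or> last p \<noteq> last p'"
      by (rule common_suffix)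
    have r: "reduced b" "reduced b'" "b \<in> K" "b' \<in> K" using b KD by (auto simp: Q_def)
    have "p @ reverse_path p' \<in> K"
      using reduce_quotient[of p s p'] KD(4)[OF r(3) KD(3)[OF r(4)]] r s by simp
    moreover from this have "p' @ reverse_path p \<in> K" using KD(3) by fastforce
    moreover have "p = [] \<or> p' = []"
    proof (rule ccontr)
      assume *: "\<not> ?thesis"
      \<comment> \<open>The first letter of this quotient is that of \<open>b\<close>, and its last
        letter is the inverse of the first letter of \<open>b'\<close>.\<close>
      then have "last (p @ reverse_path p') \<noteq> reverse_edge x" "hd (p @ reverse_path p') \<noteq> x"
        using b s by (auto simp: Q_def last_reverse_path)
      then show False using no[of "p @ reverse_path p'"] calculation * by simp
    qed
    ultimately show ?thesis using s b by (auto simp: Q_def)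
  qed
  have commute: "b @ b' = b' @ b" if "b \<in> Q" "b' \<in> Q" for b b'
    using that
  proof (induction "length b + length b'" arbitrary: b b' rule: less_induct)
    case less
    have *: "c @ u = u @ c" if "c \<in> Q" "u \<in> Q" "length (c @ u) < length b + length b'" for c u
      using less.hyps[of c u] that by simp
    have ne: "b \<noteq> []" "b' \<noteq> []" using less.prems by (auto simp: Q_def)
    from suffix[OF less.prems] show ?case
    proof (elim disjE exE conjE)
      fix c assume "c \<in> Q" "b = c @ b'"
      then show ?thesis using *[of c b'] less.prems ne by simp
    next
      fix c assume "c \<in> Q" "b' = c @ b"
      then show ?thesis using *[of c b] less.prems ne by simp
    qed simp
  qed
  \<comment> \<open>The last letter of \<open>b\<close> is \<open>reverse_edge x\<close> and its
    first is not \<open>x\<close>, so nothing cancels in \<open>b @ b\<close>.\<close>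
  have double: "b @ b \<in> Q" if "b \<in> Q" for b
    using that KD(2)[of b] KD(5)[of b b] no[of b] by (auto simp: Q_def reduced_append)
  have "\<exists>b \<in> Q. n < length b" for n
  proof (induction n)
    case 0
    then show ?case using q by (auto simp: Q_def)
  next
    case (Suc n)
    then obtain b where "b \<in> Q" "n < length b" by blast
    then show ?case using double[of b] by (intro bexI[of _ "b @ b"]) auto
  qed
  then obtain b where b: "b \<in> Q" "length a < length b" by blast
  define b' where "b' = reduce (b @ a)"
  \<comment> \<open>As \<open>a\<close> is shorter than \<open>b\<close>, the first letter of
    \<open>b\<close> survives in \<open>b'\<close>.\<close>
  have b': "b' \<in> Q"
    using hd_reduce_append[of b a] b KD(2,4) a by (auto simp: b'_def Q_def)
  have ra: "reduced a" using KD a by blast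
  \<comment> \<open>Once \<open>c\<close> has been commuted to the right end, left cancellation
    shows \<open>a\<close> to be the inverse of an element of \<open>Q\<close>, an element of
    \<open>Q\<close>, or empty. The first has the wrong last letter, the second the wrong first
    letter.\<close>
  from suffix[OF b(1) b'] show False
  proof (elim disjE exE conjE)
    fix c assume c: "c \<in> Q" "b = c @ b'"
    then have "b = b' @ c" using commute b' by metis
    then have "b @ reverse_path c = b' @ c @ reverse_path c" by simp
    then have "reduce (b @ reverse_path c) = reduce b'"
      using reduce_cancel_path[of b' c "[]"] by simp
    then have "reduce (b @ reverse_path c) = reduce (b @ a)" by (simp add: b'_def)
    then have "a = reverse_path c"
      using reduce_left_cancel[of "reverse_path c" a b] ra c KD(2) by (auto simp: Q_def)
    then show False using a c by (auto simp: Q_def last_reverse_path)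
  next
    fix c assume c: "c \<in> Q" "b' = c @ b"
    then have "b' = b @ c" using commute b by metis
    then have "reduce (b @ c) = reduce (b @ a)"
      using b' KD(2) reduce_reduced unfolding b'_def Q_def by (metis reduced_reduce)
    then have "a = c" using reduce_left_cancel[of c a b] ra c KD(2) by (auto simp: Q_def)
    then show False using a c by (auto simp: Q_def)
  next
    assume "b = b'"
    then have "reduce (b @ []) = reduce (b @ a)"
      using b KD(2) by (simp add: b'_def Q_def reduce_reduced)
    then show False using reduce_left_cancel[of "[]" a b] ra a by simp
  qed
qed

section \<open>Counting\<close>

definition sphere :: "'a list set \<Rightarrow> nat \<Rightarrow> 'a list set" where
  "sphere K n = {p \<in> K. length p = n}"

lemma finite_sphere:
  assumes "finite S" "\<And>p. p \<in> K \<Longrightarrow> set p \<subseteq> S"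
  shows "finite (sphere K n)"
  by (rule finite_subset[OF _ finite_lists_length_eq[OF assms(1), of n]])
     (use assms(2) in \<open>auto simp: sphere_def\<close>)

text \<open>The words \<open>p\<^sub>0 r p\<^sub>1 r \<dots> r p\<^sub>j\<close> with factors from
  \<open>P\<close> are reduced, and since all these factors have length \<open>n\<close>, each word
  determines them.\<close>

lemma sphere_card_power:
  assumes L: "word_group L" and fin: "\<And>m. finite (sphere L m)"
    and P: "P \<subseteq> sphere L n" "\<And>p. p \<in> P \<Longrightarrow> p \<noteq> [] \<and> hd p = x \<and> last p = y"
    and r: "r \<in> L" "reduced (y # r @ [x])"
  shows "card P ^ Suc j \<le> card (sphere L (Suc j * n + j * length r))"
proof -
  \<comment> \<open>The induction attaches \<open>p @ r\<close> on the left, so it has to remember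
    the first letter of the words built so far.\<close>
  have "\<exists>W \<subseteq> sphere L (Suc j * n + j * length r).
      (\<forall>w \<in> W. w \<noteq> [] \<and> hd w = x) \<and> card W = card P ^ Suc j"
  proof (induction j)
    case 0
    then show ?case using P by (intro exI[of _ P]) auto
  next
    case (Suc j)
    then obtain W where W: "W \<subseteq> sphere L (Suc j * n + j * length r)"
      "\<And>w. w \<in> W \<Longrightarrow> w \<noteq> [] \<and> hd w = x" "card W = card P ^ Suc j"
      by blast
    let ?f = "\<lambda>(p, w). p @ r @ w"
    have "?f ` (P \<times> W) \<subseteq> sphere L (Suc (Suc j) * n + Suc j * length r)"
    proof clarify
      fix p w assume pw: "p \<in> P" "w \<in> W"
      then have L': "p \<in> L" "w \<in> L" "length p = n" "length w = Suc j * n + j * length r"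
        using P W by (auto simp: sphere_def)
      then have "reduced p" "reduced w" using word_groupD[OF L] by auto
      then have "reduced (r @ w)" "reduced (p @ r @ w)"
        using P(2)[OF pw(1)] W(2)[OF pw(2)] r(2)
        by (auto simp: reduced_append reduced_Cons hd_append split: if_splits)
      then have "p @ r @ w \<in> L"
        using word_groupD(5)[OF L] L' r(1) by blast
      then show "p @ r @ w \<in> sphere L (Suc (Suc j) * n + Suc j * length r)"
        using L' by (simp add: sphere_def)
    qed
    moreover have "inj_on ?f (P \<times> W)"
    proof (rule inj_onI, clarify)
      fix p p' w w' assume "p \<in> P" "p' \<in> P" "p @ r @ w = p' @ r @ w'"
      moreover from this have "length p = length p'" using P(1) by (auto simp: sphere_def)
      ultimately show "p = p' \<and> w = w'" by simp
    qed
    then have "card (?f ` (P \<times> W)) = card P ^ Suc (Suc j)"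
      by (simp add: card_image card_cartesian_product W)
    moreover have "\<forall>w \<in> ?f ` (P \<times> W). w \<noteq> [] \<and> hd w = x"
      using P(2) by auto
    ultimately show ?case by blast
  qed
  then show ?thesis using card_mono[OF fin] by metis
qed

text \<open>
  Up to the constants \<open>C\<close> and \<open>d\<close>, the elements of \<open>K\<close> of length \<open>n\<close> generate freely a
  semigroup, already inside every subgroup \<open>L\<close> that contains a certain finite set.
\<close>

definition approximates ::
  "'a oriented_edge list set \<Rightarrow> 'a oriented_edge list set \<Rightarrow> nat \<Rightarrow> nat \<Rightarrow> nat \<Rightarrow> bool" where
  "approximates E K C d n \<longleftrightarrow> (\<forall>L j. word_group L \<longrightarrow> E \<subseteq> L \<longrightarrow> L \<subseteq> K \<longrightarrow> j \<ge> 1 \<longrightarrow>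
     (\<exists>l. j \<le> l \<and> l \<le> j * (n + d) \<and> card (sphere K n) ^ j \<le> C ^ j * card (sphere L l)))"

text \<open>\<open>C\<close> and \<open>d\<close> are chosen before \<open>n\<close>, so that their
  effect vanishes in the \<open>n\<close>-th root as \<open>n\<close> grows; only the finite set
  \<open>E\<close> depends on \<open>n\<close>.\<close>

definition approximable :: "'a oriented_edge list set \<Rightarrow> bool" where
  "approximable K \<longleftrightarrow>
     (\<exists>C \<ge> 1. \<exists>d. \<forall>n \<ge> 1. \<exists>E. finite E \<and> E \<subseteq> K \<and> approximates E K C d n)"

text \<open>For \<open>j \<ge> 1\<close> the power on the left of the estimate is 0, so any
  \<open>l\<close> within the bounds will do.\<close>

lemma approximates_empty_sphere:
  assumes "card (sphere K n) = 0" "n \<ge> 1"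
  shows "approximates E K C d n"
  unfolding approximates_def
proof (intro allI impI)
  fix L and j :: nat assume "j \<ge> 1"
  then show "\<exists>l \<ge> j. l \<le> j * (n + d) \<and> card (sphere K n) ^ j \<le> C ^ j * card (sphere L l)"
    using assms by (intro exI[of _ "j * (n + d)"]) (simp add: power_0_left)
qed

section \<open>Groups without a common first letter\<close>

lemma pigeonhole_image:
  assumes "finite T" "T \<noteq> {}" "A \<subseteq> (\<Union>t \<in> T. P t)" "\<And>t. t \<in> T \<Longrightarrow> finite (P t)"
  obtains t where "t \<in> T" "card A \<le> card T * card (P t)"
proof -
  let ?M = "Max ((\<lambda>t. card (P t)) ` T)"
  have "?M \<in> (\<lambda>t. card (P t)) ` T" using assms by (intro Max_in) auto
  then obtain t where t: "t \<in> T" "?M = card (P t)" by auto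
  have "card A \<le> card (\<Union>t \<in> T. P t)" using assms by (intro card_mono) auto
  also have "\<dots> \<le> (\<Sum>t \<in> T. card (P t))" by (rule card_UN_le[OF assms(1)])
  also have "\<dots> \<le> card T * card (P t)"
    using sum_bounded_above[of T "\<lambda>t. card (P t)" ?M] Max_ge[of "(\<lambda>t. card (P t)) ` T"] assms(1) t
    by simp
  finally show ?thesis using t that by blast
qed

text \<open>Pigeonhole on the pair of first and last letters loses the factor
  \<open>card (S \<times> S)\<close>, which serves as \<open>C\<close>. The bridging words depend
  only on this pair, so their lengths have a bound \<open>d\<close> independent of
  \<open>n\<close>.\<close>

lemma approximable_no_common_hd:
  fixes K :: "'a oriented_edge list set"
  assumes K: "word_group K" and S: "finite S" "\<And>p. p \<in> K \<Longrightarrow> set p \<subseteq> S"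
    and no: "\<And>x. \<exists>q \<in> K. q \<noteq> [] \<and> hd q \<noteq> x"
  shows "approximable K"
proof -
  \<comment> \<open>For first letter \<open>x\<close> and last letter \<open>y\<close>, the empty
    word is a bridge unless \<open>y\<close> is the inverse of \<open>x\<close>; in that case
    \<open>bridge_exists\<close> applies, its \<open>q\<close> coming from the absence of a common
    first letter.\<close>
  have "\<exists>r. (\<exists>p \<in> K. p \<noteq> [] \<and> hd p = fst t \<and> last p = snd t) \<longrightarrow>
      r \<in> K \<and> reduced (snd t # r @ [fst t])" for t :: "'a oriented_edge \<times> 'a oriented_edge"
  proof -
    obtain x y where Pair: "t = (x, y)" by (cases t)
    show ?thesis
    proof (cases "(\<exists>p \<in> K. p \<noteq> [] \<and> hd p = x \<and> last p = y) \<and> y = reverse_edge x")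
      case True
      then obtain p q where "p \<in> K" "p \<noteq> []" "hd p = x" "last p = reverse_edge x"
        "q \<in> K" "q \<noteq> []" "hd q \<noteq> x"
        using no by blast
      then obtain r where "r \<in> K" "r \<noteq> []" "hd r \<noteq> x" "last r \<noteq> reverse_edge x"
        using bridge_exists[OF K] by metis
      then show ?thesis
        using True Pair word_groupD(2)[OF K]
        by (intro exI[of _ r]) (auto simp: reduced_Cons reduced_append)
    next
      case False
      then show ?thesis using Pair word_groupD(1)[OF K] by (intro exI[of _ "[]"]) auto
    qed
  qed
  then obtain r where r: "\<And>x y p. p \<in> K \<Longrightarrow> p \<noteq> [] \<Longrightarrow> hd p = x \<Longrightarrow> last p = y \<Longrightarrow>
      r (x, y) \<in> K \<and> reduced (y # r (x, y) @ [x])"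
    by (metis fst_conv snd_conv)
  let ?T = "S \<times> S"
  have "finite ((\<lambda>t. length (r t)) ` ?T)" using S by simp
  then obtain d where d: "\<And>t. t \<in> ?T \<Longrightarrow> length (r t) \<le> d"
    unfolding finite_nat_set_iff_bounded_le by blast
  have hdlast: "hd p \<in> S" "last p \<in> S" if "p \<in> K" "p \<noteq> []" for p
    using S(2)[OF that(1)] that(2) by auto
  have T: "finite ?T" "?T \<noteq> {}" using S hdlast no by blast+
  have fin: "finite (sphere K m)" for m using finite_sphere S by blast
  show ?thesis
    unfolding approximable_def
  proof (rule exI[of _ "card ?T"], intro conjI exI[of _ d] allI impI)
    show "1 \<le> card ?T" using T by (simp add: Suc_le_eq card_gt_0_iff)
    fix n :: nat assume n: "n \<ge> 1"
    define P where "P = (\<lambda>(x, y). {p \<in> sphere K n. hd p = x \<and> last p = y})"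
    have "sphere K n \<subseteq> (\<Union>t \<in> ?T. P t)"
      using hdlast n by (fastforce simp: P_def sphere_def)
    moreover have "finite (P t)" for t using fin by (auto simp: P_def split: prod.split)
    ultimately obtain t where t: "t \<in> ?T" "card (sphere K n) \<le> card ?T * card (P t)"
      using pigeonhole_image[OF T] by metis
    obtain x y where xy: "t = (x, y)" by (cases t)
    have P: "p \<in> K \<and> length p = n \<and> p \<noteq> [] \<and> hd p = x \<and> last p = y" if "p \<in> P t" for p
      using that n by (auto simp: P_def xy sphere_def)
    show "\<exists>E. finite E \<and> E \<subseteq> K \<and> approximates E K (card ?T) d n"
    proof (cases "P t = {}")
      case True
      then have "card (sphere K n) = 0" using t by simp
      then show ?thesis
        using n by (intro exI[of _ "{}"]) (simp add: approximates_empty_sphere)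
    next
      case False
      then have rt: "r t \<in> K" "reduced (y # r t @ [x])" using r P unfolding xy by blast+
      show ?thesis
        unfolding approximates_def
      \<comment> \<open>A subgroup that contains the bridge and the words to be joined contains all
        the products.\<close>
      proof (intro exI[of _ "insert (r t) (P t)"] conjI allI impI)
        show "finite (insert (r t) (P t))" using \<open>finite (P t)\<close> by simp
        show "insert (r t) (P t) \<subseteq> K" using rt P by blast
        fix L and j :: nat
        assume L: "word_group L" "insert (r t) (P t) \<subseteq> L" "L \<subseteq> K" and "j \<ge> 1"
        then obtain i where j: "j = Suc i" by (cases j) auto
        \<comment> \<open>There are \<open>j = Suc i\<close> factors of length \<open>n\<close> and
          \<open>i\<close> bridges between them.\<close>
        let ?l = "Suc i * n + i * length (r t)"
        have "finite (sphere L m)" for m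
          using fin[of m] L by (rule_tac finite_subset) (auto simp: sphere_def)
        then have "card (P t) ^ j \<le> card (sphere L ?l)"
          unfolding j by (rule_tac sphere_card_power[where x = x and y = y])
            (use L P rt in \<open>auto simp: sphere_def\<close>)
        then have "card (sphere K n) ^ j \<le> card ?T ^ j * card (sphere L ?l)"
          using power_mono[OF t(2), of j] by (simp add: power_mult_distrib)
            (meson le_trans mult_le_mono2)
        moreover have "j \<le> ?l"
          using trans_le_add1[OF mult_le_mono2[OF n, of "Suc i"]] unfolding j by (simp only: mult_1_right)
        moreover have "i * length (r t) \<le> Suc i * d"
          by (rule mult_le_mono) (use d t in auto)
        then have "?l \<le> j * (n + d)" unfolding j by (simp add: add_mult_distrib2)
        ultimately show "\<exists>l. j \<le> l \<and> l \<le> j * (n + d) \<and>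
            card (sphere K n) ^ j \<le> card ?T ^ j * card (sphere L l)"
          by (intro exI[of _ ?l] conjI)
      qed
    qed
  qed
qed

text \<open>A conjugate of \<open>K\<close>, meant for the case that every nontrivial element of
  \<open>K\<close> begins with \<open>x\<close>. The empty word is added by hand, because
  \<open>x\<close> followed by its inverse is not reduced.\<close>

definition strip :: "'a oriented_edge \<Rightarrow> 'a oriented_edge list set \<Rightarrow> 'a oriented_edge list set" where
  "strip x K = insert [] {p. x # p @ [reverse_edge x] \<in> K}"

section \<open>Groups whose nontrivial elements share their first letter\<close>

context
  fixes K :: "'a oriented_edge list set" and x :: "'a oriented_edge"
  assumes K: "word_group K" and common: "\<And>p. p \<in> K \<Longrightarrow> p \<noteq> [] \<Longrightarrow> hd p = x"
begin

text \<open>The inverse of \<open>p\<close> begins with \<open>x\<close> too, so \<open>p\<close>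
  ends with \<open>reverse_edge x\<close>. The middle part cannot be empty, as \<open>p\<close> is
  reduced.\<close>

lemma word_group_common_hd:
  assumes "p \<in> K" "p \<noteq> []"
  obtains q where "q \<noteq> []" "p = x # q @ [reverse_edge x]"
proof -
  have "hd (reverse_path p) = x"
    using word_groupD(3)[OF K assms(1)] assms(2) common by simp
  then have "last p = reverse_edge x"
    using assms(2) by (simp add: hd_reverse_path) (metis reverse_edge_reverse_edge)
  then obtain p0 where p0: "p = p0 @ [reverse_edge x]"
    using assms(2) by (metis append_butlast_last_id)
  with common[OF assms] obtain q where q: "p0 = x # q"
    by (cases p0) auto
  have "q \<noteq> []" using word_groupD(2)[OF K assms(1)] p0 q by auto
  then show ?thesis using that p0 q by simp
qed

text \<open>The conjugate of a product reduces to an element of \<open>K\<close>, and so is empty or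
  has \<open>x\<close> and its inverse at the ends; conjugating back gives the reduced
  product.\<close>

lemma word_group_strip: "word_group (strip x K)"
proof -
  let ?c = "\<lambda>p. x # p @ [reverse_edge x]"
  have conj: "reduce (reverse_edge x # ?c p @ [x]) = reduce p" for p
    using reduce_cancel(2)[of "[]" x "p @ [reverse_edge x, x]"] reduce_cancel(2)[of p x "[]"] by simp
  have red: "reduced p" if "p \<in> strip x K" for p
    using that word_groupD(2)[OF K, of "?c p"] by (auto simp: strip_def reduced_Cons reduced_append)
  have "reverse_path p \<in> strip x K" if "p \<in> strip x K" for p
    using that word_groupD(3)[OF K, of "?c p"] by (auto simp: strip_def)
  moreover have "reduce (p @ q) \<in> strip x K" if "p \<in> strip x K" "q \<in> strip x K" for p q
  proof (cases "p = [] \<or> q = []")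
    case True
    then show ?thesis using that red reduce_reduced by fastforce
  next
    case False
    then have "?c p \<in> K" "?c q \<in> K" using that by (auto simp: strip_def)
    then have "reduce (?c p @ ?c q) \<in> K" by (rule word_groupD(4)[OF K])
    also have "reduce (?c p @ ?c q) = reduce (?c (p @ q))"
      using reduce_cancel(2)[of "x # p" x "q @ [reverse_edge x]"] by simp
    finally have c: "reduce (?c (p @ q)) \<in> K" .
    have r: "reduce (p @ q) = reduce (reverse_edge x # reduce (?c (p @ q)) @ [x])"
      using conj[of "p @ q"] reduce_reduce_left[of "?c (p @ q)" "[x]"]
      by (simp add: reduce_Cons)
    show ?thesis
    proof (cases "reduce (?c (p @ q)) = []")
      case True
      then have "reduce (p @ q) = []" using r by (simp add: reduce_Cons)
      then show ?thesis by (simp add: strip_def)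
    next
      case False
      with c obtain s where s: "reduce (?c (p @ q)) = ?c s" using word_group_common_hd by metis
      then have "s \<in> strip x K" using c by (simp add: strip_def)
      moreover have "reduce (p @ q) = s"
        using r conj[of s] red[OF \<open>s \<in> strip x K\<close>] unfolding s by (simp add: reduce_reduced)
      ultimately show ?thesis by simp
    qed
  qed
  ultimately show ?thesis
    using red unfolding word_group_def by (auto simp: strip_def)
qed

text \<open>Conjugation adds two letters to each nonempty word; \<open>n \<ge> 1\<close> leaves out
  the empty word, which stays empty.\<close>

lemma card_sphere_strip:
  assumes "n \<ge> 1"
  shows "card (sphere K (n + 2)) = card (sphere (strip x K) n)"
proof -
  have "sphere K (n + 2) = (\<lambda>p. x # p @ [reverse_edge x]) ` sphere (strip x K) n"
  proof (intro equalityI subsetI)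
    fix p assume p: "p \<in> sphere K (n + 2)"
    then have "p \<in> K" "p \<noteq> []" by (auto simp: sphere_def)
    then obtain q where "p = x # q @ [reverse_edge x]" using word_group_common_hd by metis
    then show "p \<in> (\<lambda>p. x # p @ [reverse_edge x]) ` sphere (strip x K) n"
      using p by (auto simp: sphere_def strip_def)
  qed (use assms in \<open>auto simp: sphere_def strip_def\<close>)
  then show ?thesis by (simp add: card_image inj_on_def)
qed

text \<open>Conjugation shifts \<open>n\<close> and \<open>l\<close> by 2 each. \<open>C\<close> and
  \<open>d\<close> can be kept, since the upper bound for \<open>l\<close> grows by
  \<open>2 * j \<ge> 2\<close>.\<close>

lemma approximable_strip:
  assumes "approximable (strip x K)"
  shows "approximable K"
proof -
  obtain C d where C: "C \<ge> 1" and A: "\<And>n. n \<ge> 1 \<Longrightarrow>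
      \<exists>E. finite E \<and> E \<subseteq> strip x K \<and> approximates E (strip x K) C d n"
    using assms unfolding approximable_def by blast
  show ?thesis
    unfolding approximable_def
  proof (rule exI[of _ C], intro conjI exI[of _ d] allI impI)
    fix n :: nat assume n: "n \<ge> 1"
    show "\<exists>E. finite E \<and> E \<subseteq> K \<and> approximates E K C d n"
    proof (cases "n \<le> 2")
      case True
      have "length p > 2" if p: "p \<in> K" "p \<noteq> []" for p
      proof -
        obtain q where "q \<noteq> []" "p = x # q @ [reverse_edge x]"
          using word_group_common_hd[OF p] by blast
        then show ?thesis by (cases q) auto
      qed
      then have "sphere K n = {}" using n True by (fastforce simp: sphere_def)
      then show ?thesis
        using n by (intro exI[of _ "{}"]) (simp add: approximates_empty_sphere)
    next
      case False
      define m where "m = n - 2"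
      with False have m: "n = m + 2" "m \<ge> 1" by auto
      obtain E where E: "finite E" "E \<subseteq> strip x K" "approximates E (strip x K) C d m"
        using A[OF m(2)] by blast
      \<comment> \<open>The empty word lies in \<open>strip x L\<close> anyway, while
        \<open>[x, reverse_edge x]\<close> is not reduced and hence not in \<open>K\<close>.\<close>
      let ?E = "(\<lambda>p. x # p @ [reverse_edge x]) ` (E - {[]})"
      show ?thesis
        unfolding approximates_def
      proof (intro exI[of _ ?E] conjI allI impI)
        show "finite ?E" "?E \<subseteq> K" using E by (auto simp: strip_def)
        fix L and j :: nat
        assume L: "word_group L" "?E \<subseteq> L" "L \<subseteq> K" and j: "j \<ge> 1"
        have hd: "hd p = x" if "p \<in> L" "p \<noteq> []" for p
          using that L common by blast
        have wL: "word_group (strip x L)"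
          by (rule Submission.word_group_strip[OF L(1) hd])
        have sub: "E \<subseteq> strip x L" "strip x L \<subseteq> strip x K" using L by (auto simp: strip_def)
        obtain l where l: "j \<le> l" "l \<le> j * (m + d)"
          "card (sphere (strip x K) m) ^ j \<le> C ^ j * card (sphere (strip x L) l)"
          using E(3) wL sub j unfolding approximates_def by blast
        have "card (sphere L (l + 2)) = card (sphere (strip x L) l)"
          using l(1) j by (intro Submission.card_sphere_strip[OF L(1) hd]) auto
        moreover have "card (sphere K n) = card (sphere (strip x K) m)"
          using card_sphere_strip m by simp
        ultimately have "card (sphere K n) ^ j \<le> C ^ j * card (sphere L (l + 2))"
          using l(3) by simp
        moreover have "l + 2 \<le> j * (n + d)"
          using l(2) j unfolding m by (simp add: algebra_simps)
        ultimately show "\<exists>l. j \<le> l \<and> l \<le> j * (n + d) \<and>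
            card (sphere K n) ^ j \<le> C ^ j * card (sphere L l)"
          using l(1) by (intro exI[of _ "l + 2"]) simp
      qed
    qed
  qed (rule C)
qed

end

text \<open>Each conjugation shortens the nontrivial element \<open>u\<close> by two letters and
  keeps it nontrivial, so after finitely many of them no common first letter is left.\<close>

lemma approximable_word_group:
  assumes "word_group K" "finite S" "\<And>p. p \<in> K \<Longrightarrow> set p \<subseteq> S" "u \<in> K" "u \<noteq> []"
  shows "approximable K"
  using assms(1,3-)
proof (induction "length u" arbitrary: K u rule: less_induct)
  case less
  show ?case
  proof (cases "\<exists>x. \<forall>q \<in> K. q \<noteq> [] \<longrightarrow> hd q = x")
    case True
    then obtain x where x: "\<And>q. q \<in> K \<Longrightarrow> q \<noteq> [] \<Longrightarrow> hd q = x" by blast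
    obtain q where q: "q \<noteq> []" "u = x # q @ [reverse_edge x]"
      using word_group_common_hd[of K x u] less.prems x by blast
    have "approximable (strip x K)"
    proof (rule less.hyps[of q])
      show "set p \<subseteq> S" if "p \<in> strip x K" for p
        using that less.prems(2)[of "x # p @ [reverse_edge x]"] by (auto simp: strip_def)
      show "word_group (strip x K)" using word_group_strip less.prems(1) x by blast
    qed (use q less.prems in \<open>auto simp: strip_def\<close>)
    then show ?thesis using approximable_strip[of K x] less.prems(1) x by blast
  next
    case False
    then show ?thesis
      using approximable_no_common_hd[OF less.prems(1) assms(2) less.prems(2)] by blast
  qed
qed

section \<open>Growth rates\<close>

definition growth :: "'a list set \<Rightarrow> ereal" where
  "growth K = limsup (\<lambda>n. ereal (root n (real (card (sphere K n)))))"

lemma le_limsup_if_frequently: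
  fixes f :: "nat \<Rightarrow> ereal"
  assumes "\<And>N. \<exists>n \<ge> N. c \<le> f n"
  shows "c \<le> limsup f"
  unfolding limsup_INF_SUP
proof (rule INF_greatest)
  fix N
  obtain n where "n \<ge> N" "c \<le> f n" using assms by blast
  then show "c \<le> (SUP m\<in>{N..}. f m)" by (intro SUP_upper2[of n]) auto
qed

lemma frequently_greater_if_less_limsup:
  fixes f :: "nat \<Rightarrow> ereal"
  assumes "c < limsup f"
  shows "\<exists>n \<ge> N. c < f n"
proof -
  have "c < (SUP m\<in>{N..}. f m)"
    using assms unfolding limsup_INF_SUP by (rule less_INF_D) simp
  then show ?thesis by (auto simp: less_SUP_iff)
qed

lemma growth_mono:
  assumes "L \<subseteq> K" "\<And>n. finite (sphere K n)"
  shows "growth L \<le> growth K"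
  unfolding growth_def
proof (intro Limsup_mono always_eventually allI)
  fix n
  have "card (sphere L n) \<le> card (sphere K n)"
    using assms by (intro card_mono) (auto simp: sphere_def)
  then show "ereal (root n (real (card (sphere L n)))) \<le> ereal (root n (real (card (sphere K n))))"
    \<comment> \<open>\<open>root 0\<close> is constantly 0, so this index is a case of its
      own.\<close>
    by (cases "n = 0") (simp_all add: real_root_le_mono)
qed

text \<open>Choose \<open>c'\<close> between \<open>c\<close> and the growth of \<open>K\<close>,
  then \<open>n\<close> with at least \<open>c' ^ n\<close> elements of length \<open>n\<close>, so
  large that \<open>(c' / c) ^ n\<close> absorbs \<open>C * c ^ d\<close>. Then
  \<open>(C * c ^ (n + d)) ^ j \<le> C ^ j * card (sphere L l)\<close>, and cancelling
  \<open>C ^ j\<close> leaves \<open>c ^ l\<close> as a lower bound.\<close>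

lemma approximable_growth:
  assumes ap: "approximable K" and c: "1 \<le> c" "ereal c < growth K"
  shows "\<exists>E. finite E \<and> E \<subseteq> K \<and>
    (\<forall>L. word_group L \<longrightarrow> E \<subseteq> L \<longrightarrow> L \<subseteq> K \<longrightarrow> ereal c \<le> growth L)"
proof -
  obtain C d where C: "C \<ge> 1" and
    A: "\<And>n. n \<ge> 1 \<Longrightarrow> \<exists>E. finite E \<and> E \<subseteq> K \<and> approximates E K C d n"
    using ap unfolding approximable_def by blast
  obtain c' where c': "c < c'" "ereal c' < growth K"
    using ereal_dense2[OF c(2)] by auto
  have "1 < c' / c" using c c' by simp
  then obtain N where N: "real C * c ^ d < (c' / c) ^ N" using real_arch_pow by blast
  have "\<exists>n \<ge> Suc N. ereal c' < ereal (root n (real (card (sphere K n))))"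
    by (rule frequently_greater_if_less_limsup) (use c'(2) in \<open>simp add: growth_def\<close>)
  then obtain n where n: "n \<ge> Suc N" "c' < root n (real (card (sphere K n)))" by auto
  have "(c' / c) ^ N \<le> (c' / c) ^ n" using \<open>1 < c' / c\<close> n by (intro power_increasing) auto
  with N have "real C * c ^ d \<le> c' ^ n / c ^ n" by (simp add: power_divide)
  then have "real C * c ^ (n + d) \<le> c' ^ n"
    using c by (simp add: pos_le_divide_eq power_add mult_ac)
  also have "\<dots> \<le> root n (real (card (sphere K n))) ^ n"
    using n c c' by (intro power_mono) auto
  also have "\<dots> = real (card (sphere K n))" using n by simp
  finally have large: "real C * c ^ (n + d) \<le> real (card (sphere K n))" .
  obtain E where E: "finite E" "E \<subseteq> K" "approximates E K C d n" using A[of n] n by auto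
  show ?thesis
  proof (intro exI[of _ E] conjI allI impI)
    fix L assume L: "word_group L" "E \<subseteq> L" "L \<subseteq> K"
    show "ereal c \<le> growth L"
      unfolding growth_def
    proof (rule le_limsup_if_frequently)
      fix M
      \<comment> \<open>As \<open>j \<le> l\<close>, this gives lengths \<open>l\<close> beyond
        every \<open>M\<close>.\<close>
      define j where "j = Suc M"
      have j: "j \<ge> 1" "j \<ge> M" by (simp_all add: j_def)
      obtain l where l: "j \<le> l" "l \<le> j * (n + d)"
        "card (sphere K n) ^ j \<le> C ^ j * card (sphere L l)"
        using E(3) L j(1) unfolding approximates_def by blast
      \<comment> \<open>Because \<open>c \<ge> 1\<close>, the upper bound on \<open>l\<close> bounds
        \<open>c ^ l\<close>.\<close>
      have "real C ^ j * c ^ l \<le> real C ^ j * c ^ ((n + d) * j)"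
        using c l by (intro mult_left_mono power_increasing) (auto simp: mult.commute)
      also have "\<dots> = (real C * c ^ (n + d)) ^ j" by (simp add: power_mult_distrib power_mult)
      also have "\<dots> \<le> real (card (sphere K n)) ^ j" using large c by (intro power_mono) auto
      also have "\<dots> \<le> real C ^ j * real (card (sphere L l))"
        using l(3) by (metis of_nat_le_iff of_nat_mult of_nat_power)
      finally have "c ^ l \<le> real (card (sphere L l))" using C by simp
      then have "root l (c ^ l) \<le> root l (real (card (sphere L l)))"
        using l j by (intro real_root_le_mono) auto
      then have "c \<le> root l (real (card (sphere L l)))"
        using c l j by (simp add: real_root_power_cancel)
      then show "\<exists>l \<ge> M. ereal c \<le> ereal (root l (real (card (sphere L l))))"
        using l j by (intro exI[of _ l]) auto
    qed
  qed (use E in auto)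
qed

text \<open>This covers thresholds \<open>c\<close> below 1, whose powers decrease. One nonempty
  sphere of \<open>K\<close> yields nonempty spheres of \<open>L\<close> of arbitrarily large
  radius, and their roots are at least 1.\<close>

lemma approximable_growth_ge_1:
  assumes ap: "approximable K" and fin: "\<And>n. finite (sphere K n)" and u: "u \<in> K" "u \<noteq> []"
  shows "\<exists>E. finite E \<and> E \<subseteq> K \<and>
    (\<forall>L. word_group L \<longrightarrow> E \<subseteq> L \<longrightarrow> L \<subseteq> K \<longrightarrow> 1 \<le> growth L)"
proof -
  let ?n = "length u"
  have n: "?n \<ge> 1" using u by (simp add: Suc_le_eq)
  obtain C d E where E: "finite E" "E \<subseteq> K" "approximates E K C d ?n"
    using ap n unfolding approximable_def by blast
  have "sphere K ?n \<noteq> {}" using u by (auto simp: sphere_def)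
  then have pos: "card (sphere K ?n) > 0" using fin by (simp add: card_gt_0_iff)
  show ?thesis
  proof (intro exI[of _ E] conjI allI impI)
    fix L assume L: "word_group L" "E \<subseteq> L" "L \<subseteq> K"
    show "1 \<le> growth L"
      unfolding growth_def
    proof (rule le_limsup_if_frequently)
      fix M
      obtain l where l: "Suc M \<le> l" "card (sphere K ?n) ^ Suc M \<le> C ^ Suc M * card (sphere L l)"
        using E(3) L le_add1[of 1 M] unfolding approximates_def plus_1_eq_Suc by blast
      have "card (sphere K ?n) ^ Suc M > 0" using pos by simp
      with l(2) have "C ^ Suc M * card (sphere L l) > 0" by linarith
      then have "root l 1 \<le> root l (real (card (sphere L l)))"
        using l(1) by (intro real_root_le_mono) auto
      then show "\<exists>l \<ge> M. 1 \<le> ereal (root l (real (card (sphere L l))))"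
        using l(1) by (intro exI[of _ l]) (auto simp: one_ereal_def)
    qed
  qed (use E in auto)
qed

text \<open>The finite set \<open>E\<close> witnesses a lower bound for the growth, as the passage
  to a union requires. The trivial group is separate, since approximability is derived from a
  nontrivial element; its only subgroup is itself.\<close>

lemma growth_lower_semicontinuous:
  assumes K: "word_group K" and S: "finite S" "\<And>p. p \<in> K \<Longrightarrow> set p \<subseteq> S"
    and c: "ereal c < growth K"
  shows "\<exists>E. finite E \<and> E \<subseteq> K \<and>
    (\<forall>L. word_group L \<longrightarrow> E \<subseteq> L \<longrightarrow> L \<subseteq> K \<longrightarrow> ereal c \<le> growth L)"
proof (cases "K = {[]}")
  case True
  have "ereal c \<le> growth L" if "word_group L" "L \<subseteq> K" for L
  proof -
    have "L = K" using that True word_groupD(1) by blast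
    then show ?thesis using c by simp
  qed
  then show ?thesis by blast
next
  case False
  then obtain u where u: "u \<in> K" "u \<noteq> []" using word_groupD(1)[OF K] by blast
  have ap: "approximable K" by (rule approximable_word_group[OF K S u])
  have fin: "finite (sphere K n)" for n using finite_sphere S by blast
  show ?thesis
  proof (cases "1 \<le> c")
    case True
    then show ?thesis using approximable_growth[OF ap _ c] by blast
  next
    case False
    then have "ereal c \<le> 1" by (simp add: one_ereal_def)
    then show ?thesis
      using approximable_growth_ge_1[OF ap fin u] order_trans by meson
  qed
qed

section \<open>Growth along an increasing union\<close>

lemma finite_subset_incseq:
  assumes "finite E" "E \<subseteq> (\<Union>i. K i)" "incseq K"
  obtains i where "E \<subseteq> K i"
proof -
  have "\<exists>i. E \<subseteq> K i"
    using assms(1,2)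
  proof (induction E)
    case (insert x E)
    then obtain i j where "E \<subseteq> K i" "x \<in> K j" by auto
    then have "insert x E \<subseteq> K (max i j)"
      using incseqD[OF assms(3), of i "max i j"] incseqD[OF assms(3), of j "max i j"] by auto
    then show ?case by blast
  qed simp
  then show ?thesis using that by blast
qed

text \<open>By monotonicity the growth rates converge to their supremum. A supremum below the growth
  of the union would leave room for some \<open>c\<close>, whose finite witness \<open>E\<close>
  already lies in some \<open>K i\<close>.\<close>

lemma growth_union:
  assumes K: "\<And>i. word_group (K i)" and S: "finite S" "\<And>i p. p \<in> K i \<Longrightarrow> set p \<subseteq> S"
    and "incseq K" and U: "word_group (\<Union>i. K i)"
  shows "(\<lambda>i. growth (K i)) \<longlonglongrightarrow> growth (\<Union>i. K i)"
proof -
  have SU: "\<And>p. p \<in> (\<Union>i. K i) \<Longrightarrow> set p \<subseteq> S" using S by blast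
  have fin: "finite (sphere (K i) n)" "finite (sphere (\<Union>i. K i) n)" for i n
    using finite_sphere[OF S(1)] S(2) SU by metis+
  have "incseq (\<lambda>i. growth (K i))"
    using \<open>incseq K\<close> fin by (auto simp: incseq_def intro!: growth_mono)
  then have "(\<lambda>i. growth (K i)) \<longlonglongrightarrow> (SUP i. growth (K i))" by (rule LIMSEQ_SUP)
  moreover have "growth (\<Union>i. K i) \<le> (SUP i. growth (K i))"
  proof (rule ccontr)
    assume "\<not> ?thesis"
    then obtain c where c: "(SUP i. growth (K i)) < ereal c" "ereal c < growth (\<Union>i. K i)"
      using ereal_dense2[of "SUP i. growth (K i)" "growth (\<Union>i. K i)"] by (auto simp: not_le)
    obtain E where E: "finite E" "E \<subseteq> (\<Union>i. K i)"
      "\<And>L. word_group L \<Longrightarrow> E \<subseteq> L \<Longrightarrow> L \<subseteq> (\<Union>i. K i) \<Longrightarrow> ereal c \<le> growth L"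
      using growth_lower_semicontinuous[OF U S(1) SU c(2)] by blast
    obtain i where "E \<subseteq> K i"
      using E(1,2) \<open>incseq K\<close>
      by (rule finite_subset_incseq)
    then have "ereal c \<le> growth (K i)" using E(3)[OF K] by blast
    also have "\<dots> \<le> (SUP i. growth (K i))" by (rule SUP_upper) simp
    finally show False using c(1) by simp
  qed
  moreover have "(SUP i. growth (K i)) \<le> growth (\<Union>i. K i)"
    using fin by (intro SUP_least growth_mono) auto
  ultimately show ?thesis by (metis antisym)
qed

section \<open>The fundamental group of a bouquet as a group of reduced words\<close>

lemma not_reducedE:
  assumes "\<not> reduced p"
  obtains s x t where "p = s @ [x, reverse_edge x] @ t"
  using assms
proof (induction p arbitrary: thesis rule: induct_list012)
  case (3 x y p)
  show ?case
  proof (cases "y = reverse_edge x")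
    case True
    then show ?thesis using 3(3)[of "[]" x p] by simp
  next
    case False
    then have "\<not> reduced (y # p)" using 3(4) by simp
    then obtain s z t where "y # p = s @ [z, reverse_edge z] @ t" using 3(2) by blast
    then show ?thesis using 3(3)[of "x # s" z t] by simp
  qed
qed auto

lemma edge_path_backtrack:
  assumes "wf_digraph G" "edge_path G u (s @ [x, reverse_edge x] @ t) w"
  shows "edge_path G u (s @ t) w"
proof -
  have "terminus G (reverse_edge x) = origin G x"
    by (simp add: terminus_def origin_def reverse_edge_def)
  then show ?thesis using assms(2) by (auto simp: edge_path_append[OF assms(1)])
qed

text \<open>Deleting a backtrack yields a shorter closed path that is homotopic and has the same
  reduction.\<close>

lemma homotopic_reduce:
  assumes G: "wf_digraph G"
  shows "p \<in> closed_paths G v \<Longrightarrow> homotopic G v p (reduce p)"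
proof (induction "length p" arbitrary: p rule: less_induct)
  case less
  show ?case
  proof (cases "reduced p")
    case True
    then show ?thesis using less.prems by (simp add: reduce_reduced homotopic_refl)
  next
    case False
    then obtain s x t where p: "p = s @ [x, reverse_edge x] @ t" by (rule not_reducedE)
    then have st: "s @ t \<in> closed_paths G v"
      using less.prems edge_path_backtrack[OF G] by (auto simp: closed_paths_def)
    then have "homotopic G v p (s @ t)"
      using less.prems homotopic_backtrack p by metis
    moreover have "homotopic G v (s @ t) (reduce (s @ t))"
      using less.hyps[of "s @ t"] st p by simp
    moreover have "reduce (s @ t) = reduce p" using p by simp
    ultimately show ?thesis using homotopic_trans by metis
  qed
qed

text \<open>Backtracks do not change the reduction, so reduced closed paths are unique
  representatives of homotopy classes.\<close>

lemma homotopic_iff_reduce: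
  assumes "wf_digraph G" "p \<in> closed_paths G v" "q \<in> closed_paths G v"
  shows "homotopic G v p q \<longleftrightarrow> reduce p = reduce q"
proof
  show "reduce p = reduce q" if "homotopic G v p q"
    using that by (induction rule: homotopic.induct) auto
  show "homotopic G v p q" if "reduce p = reduce q"
    using that homotopic_reduce[OF assms(1,2)] homotopic_reduce[OF assms(1,3)]
      homotopic_sym homotopic_trans by metis
qed

text \<open>Both sides are reduced words inverse to \<open>p\<close>.\<close>

lemma reduce_reverse_path: "reduce (reverse_path p) = reverse_path (reduce p)"
proof (rule reduce_left_cancel)
  show "reduce (p @ reduce (reverse_path p)) = reduce (p @ reverse_path (reduce p))"
    using reduce_cancel_path[of "[]" p "[]"] reduce_cancel_path[of "[]" "reduce p" "[]"]
      reduce_reduce_left[of p "reverse_path (reduce p)"]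
    by simp
qed simp_all

lemma map_path_reverse_path: "map_path fe (reverse_path p) = reverse_path (map_path fe p)"
  by (auto simp: map_path_def reverse_path_def rev_map reverse_edge_def)

text \<open>The reduced representatives of the elements of \<open>pi1_image\<close>: the image
  subgroup in the model of reduced words.\<close>

definition image_words ::
  "('v, 'e) pre_digraph \<Rightarrow> 'v \<Rightarrow> ('e \<Rightarrow> 'd) \<Rightarrow> 'd oriented_edge list set" where
  "image_words J v fe = (\<lambda>p. reduce (map_path fe p)) ` closed_paths J v"

lemma word_group_image_words:
  assumes "wf_digraph J" "v \<in> verts J"
  shows "word_group (image_words J v fe)"
  unfolding word_group_def
proof (intro conjI ballI)
  show "[] \<in> image_words J v fe"
    unfolding image_words_def
    by (rule image_eqI[of _ _ "[]"]) (use assms in \<open>simp_all add: map_path_def closed_paths_def\<close>)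
  fix p assume "p \<in> image_words J v fe"
  then obtain p' where p: "p' \<in> closed_paths J v" "p = reduce (map_path fe p')"
    unfolding image_words_def by blast
  show "reduced p" using p by simp
  show "reverse_path p \<in> image_words J v fe"
    unfolding image_words_def
  proof (rule image_eqI)
    show "reverse_path p' \<in> closed_paths J v"
      using p(1) edge_path_reverse[OF assms(1)] by (simp add: closed_paths_def)
  qed (simp add: p map_path_reverse_path reduce_reverse_path)
  fix q assume "q \<in> image_words J v fe"
  then obtain q' where q: "q' \<in> closed_paths J v" "q = reduce (map_path fe q')"
    unfolding image_words_def by blast
  show "reduce (p @ q) \<in> image_words J v fe"
    unfolding image_words_def
    by (rule image_eqI[OF _ closed_paths_append[OF assms(1) p(1) q(1)]])
       (simp add: p q map_path_append)
qed

section \<open>Word length and growth in the fundamental group of a bouquet\<close>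

context
  fixes B :: "('w, 'd) pre_digraph" and b :: 'w
  assumes B: "bouquet B b"
begin

lemma bouquet_wf_digraph: "wf_digraph B"
  using B by (simp add: bouquet_def fin_digraph_def)

lemma bouquet_edge_ends:
  "fst x \<in> arcs B \<Longrightarrow> origin B x = b" "fst x \<in> arcs B \<Longrightarrow> terminus B x = b"
proof -
  have "tail B e = b" "head B e = b" if "e \<in> arcs B" for e
    using wf_digraph.tail_in_verts[OF bouquet_wf_digraph that]
      wf_digraph.head_in_verts[OF bouquet_wf_digraph that] B
    by (simp_all add: bouquet_def)
  then show "fst x \<in> arcs B \<Longrightarrow> origin B x = b" "fst x \<in> arcs B \<Longrightarrow> terminus B x = b"
    by (simp_all add: origin_def terminus_def)
qed

text \<open>All oriented edges start and end at the only vertex, so they can be concatenated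
  freely.\<close>

lemma bouquet_closed_paths: "p \<in> closed_paths B b \<longleftrightarrow> fst ` set p \<subseteq> arcs B"
proof -
  have "b \<in> verts B" using B by (simp add: bouquet_def)
  then have "edge_path B b p b \<longleftrightarrow> fst ` set p \<subseteq> arcs B"
  proof (induction p)
    case (Cons x p)
    then show ?case by (cases "fst x \<in> arcs B") (simp_all add: bouquet_edge_ends)
  qed simp
  then show ?thesis by (simp add: closed_paths_def)
qed

lemma bouquet_class_eq_iff:
  assumes "p \<in> closed_paths B b" "q \<in> closed_paths B b"
  shows "homotopy B b `` {p} = homotopy B b `` {q} \<longleftrightarrow> reduce p = reduce q"
  unfolding homotopy_class_eq_iff[OF assms]
  by (rule homotopic_iff_reduce[OF bouquet_wf_digraph assms])

text \<open>Traversing a loop backwards inverts its class, so the letters counted by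
  \<open>word_length\<close> are the oriented edges.\<close>

lemma loop_basis_inverses:
  "loop_basis B b \<union> m_inv (fundamental_group B b) ` loop_basis B b =
     (\<lambda>x. homotopy B b `` {[x]}) ` {x. fst x \<in> arcs B}"
proof -
  let ?F = "fundamental_group B b" and ?c = "\<lambda>p. homotopy B b `` {p}"
  have b: "b \<in> verts B" using B by (simp add: bouquet_def)
  interpret F: group ?F by (rule group_fundamental_group[OF bouquet_wf_digraph b])
  have inv: "m_inv ?F (?c [(e, True)]) = ?c [(e, False)]" if e: "e \<in> arcs B" for e
  proof (rule F.inv_equality)
    have cp: "[(e, s)] \<in> closed_paths B b" "[(e, s), (e, t)] \<in> closed_paths B b"
      "[] \<in> closed_paths B b" for s t
      using e by (simp_all add: bouquet_closed_paths)
    have "reduce [(e, False), (e, True)] = []"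
      by (simp add: reduce_Cons reverse_edge_def)
    then show "?c [(e, False)] \<otimes>\<^bsub>?F\<^esub> ?c [(e, True)] = \<one>\<^bsub>?F\<^esub>"
      using cp bouquet_class_eq_iff[OF cp(2) cp(3)]
      by (simp add: mult_fundamental_group[OF bouquet_wf_digraph]) (simp add: fundamental_group_def)
    show "?c [(e, True)] \<in> carrier ?F" "?c [(e, False)] \<in> carrier ?F"
      using cp by (auto simp: fundamental_group_def quotient_def)
  qed
  have "loop_basis B b = (\<lambda>e. ?c [(e, True)]) ` arcs B" by (auto simp: loop_basis_def)
  moreover from this have "m_inv ?F ` loop_basis B b = (\<lambda>e. ?c [(e, False)]) ` arcs B"
    using inv by (auto simp: image_image)
  moreover have "{x. fst x \<in> arcs B} = (\<lambda>e. (e, True)) ` arcs B \<union> (\<lambda>e. (e, False)) ` arcs B"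
    by (auto simp: image_iff)
  ultimately show ?thesis by (simp add: image_Un image_image)
qed

lemma foldr_mult_classes:
  assumes "fst ` set u \<subseteq> arcs B"
  shows "foldr (monoid.mult (fundamental_group B b)) (map (\<lambda>x. homotopy B b `` {[x]}) u)
    \<one>\<^bsub>fundamental_group B b\<^esub> = homotopy B b `` {u}"
  using assms
proof (induction u)
  case Nil
  then show ?case by (simp add: fundamental_group_def)
next
  case (Cons x u)
  then show ?case
    using mult_fundamental_group[OF bouquet_wf_digraph, of "[x]" b u]
    by (simp add: bouquet_closed_paths)
qed

text \<open>The reduced word spells the element. Any other spelling has the same reduction, and
  reducing never lengthens a word.\<close>

lemma word_length_class:
  assumes "p \<in> closed_paths B b"
  shows "word_length (fundamental_group B b) (loop_basis B b) (homotopy B b `` {p}) =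
    length (reduce p)"
  unfolding word_length_def loop_basis_inverses
proof (rule Least_equality)
  let ?c = "\<lambda>x. homotopy B b `` {[x]}"
  have "reduce p \<in> closed_paths B b"
    using homotopic_closed[OF homotopic_reduce[OF bouquet_wf_digraph assms]] by simp
  then show "\<exists>ws. length ws = length (reduce p) \<and> set ws \<subseteq> ?c ` {x. fst x \<in> arcs B} \<and>
      foldr (monoid.mult (fundamental_group B b)) ws \<one>\<^bsub>fundamental_group B b\<^esub> =
        homotopy B b `` {p}"
    using assms
    by (intro exI[of _ "map ?c (reduce p)"])
       (auto simp: foldr_mult_classes bouquet_class_eq_iff bouquet_closed_paths)
next
  fix n
  let ?c = "\<lambda>x. homotopy B b `` {[x]}"
  assume "\<exists>ws. length ws = n \<and> set ws \<subseteq> ?c ` {x. fst x \<in> arcs B} \<and>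
      foldr (monoid.mult (fundamental_group B b)) ws \<one>\<^bsub>fundamental_group B b\<^esub> =
        homotopy B b `` {p}"
  then obtain ws where ws: "length ws = n" "set ws \<subseteq> ?c ` {x. fst x \<in> arcs B}"
    "foldr (monoid.mult (fundamental_group B b)) ws \<one>\<^bsub>fundamental_group B b\<^esub> =
        homotopy B b `` {p}"
    by blast
  from ws(2) have "\<exists>u. fst ` set u \<subseteq> arcs B \<and> ws = map ?c u"
  proof (induction ws)
    case (Cons w ws)
    then obtain x u where "fst x \<in> arcs B" "w = ?c x" "fst ` set u \<subseteq> arcs B" "ws = map ?c u"
      by auto
    then show ?case by (intro exI[of _ "x # u"]) simp
  qed simp
  then obtain u where u: "fst ` set u \<subseteq> arcs B" "ws = map ?c u" by blast
  then have "homotopy B b `` {u} = homotopy B b `` {p}" using ws(3) foldr_mult_classes by simp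
  then have "reduce u = reduce p" using u assms bouquet_class_eq_iff bouquet_closed_paths by blast
  then show "length (reduce p) \<le> n" using ws(1) u length_reduce_le[of u] by simp
qed

context
  fixes J :: "('v, 'e) pre_digraph" and v :: 'v and fv :: "'v \<Rightarrow> 'w" and fe :: "'e \<Rightarrow> 'd"
  assumes J: "graph_map J B fv fe" and v: "v \<in> verts J"
begin

lemma map_path_closed_bouquet:
  assumes "p \<in> closed_paths J v"
  shows "map_path fe p \<in> closed_paths B b"
proof -
  have "fv v = b" using J v B by (auto simp: graph_map_def bouquet_def)
  then show ?thesis using assms map_path_closed[OF J, of v p v] by (simp add: closed_paths_def)
qed

lemma image_words_closed: "image_words J v fe \<subseteq> closed_paths B b"
  using homotopic_closed[OF homotopic_reduce[OF bouquet_wf_digraph map_path_closed_bouquet]]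
  by (auto simp: image_words_def)

lemma pi1_image_eq: "pi1_image J v B b fe = (\<lambda>u. homotopy B b `` {u}) ` image_words J v fe"
proof -
  have fv: "fv v = b" using J v B by (auto simp: graph_map_def bouquet_def)
  have "carrier (fundamental_group J v) = (\<lambda>p. homotopy J v `` {p}) ` closed_paths J v"
    by (auto simp: fundamental_group_def quotient_def)
  then have "pi1_image J v B b fe = (\<lambda>p. homotopy B b `` {map_path fe p}) ` closed_paths J v"
    using induced_map_class[OF J, of _ v] unfolding pi1_image_def fv by (simp add: image_image)
  also have "\<dots> = (\<lambda>p. homotopy B b `` {reduce (map_path fe p)}) ` closed_paths J v"
  proof (rule image_cong[OF refl])
    fix p assume p: "p \<in> closed_paths J v"
    then have "reduce (map_path fe p) \<in> closed_paths B b"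
      using image_words_closed by (auto simp: image_words_def)
    then show "homotopy B b `` {map_path fe p} = homotopy B b `` {reduce (map_path fe p)}"
      using p map_path_closed_bouquet bouquet_class_eq_iff by simp
  qed
  finally show ?thesis by (simp add: image_words_def image_image)
qed

text \<open>Distinct reduced words represent distinct elements, and the word length of an element is
  the length of its reduced word, so spheres correspond bijectively.\<close>

lemma growth_rate_eq_growth:
  "growth_rate (fundamental_group B b) (loop_basis B b) (pi1_image J v B b fe) =
     growth (image_words J v fe)"
proof -
  let ?c = "\<lambda>u. homotopy B b `` {u}"
  have red: "reduced u" if "u \<in> image_words J v fe" for u
    using that by (auto simp: image_words_def)
  have "card {g \<in> pi1_image J v B b fe. word_length (fundamental_group B b) (loop_basis B b) g = n}
      = card (sphere (image_words J v fe) n)" for n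
  proof -
    have wl: "word_length (fundamental_group B b) (loop_basis B b) (?c u) = length u"
      if "u \<in> image_words J v fe" for u
      using that red image_words_closed by (auto simp: word_length_class reduce_reduced)
    have "{g \<in> pi1_image J v B b fe. word_length (fundamental_group B b) (loop_basis B b) g = n}
        = ?c ` sphere (image_words J v fe) n"
      using wl by (auto simp: pi1_image_eq sphere_def)
    moreover have "inj_on ?c (sphere (image_words J v fe) n)"
    proof (rule inj_onI)
      fix p q assume "p \<in> sphere (image_words J v fe) n" "q \<in> sphere (image_words J v fe) n"
        and eq: "?c p = ?c q"
      then have "p \<in> image_words J v fe" "q \<in> image_words J v fe" by (auto simp: sphere_def)
      then show "p = q"
        using eq bouquet_class_eq_iff[of p q] image_words_closed red reduce_reduced
        by (metis subsetD)
    qed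
    ultimately show ?thesis by (simp add: card_image)
  qed
  then show ?thesis by (simp add: growth_rate_def growth_def)
qed

end

end

section \<open>Closed paths in subgraphs and the limit\<close>

lemma subgraph_ends:
  assumes "subgraph G H"
  shows "origin G x = origin H x" "terminus G x = terminus H x"
  using assms by (simp_all add: subgraph_def compatible_def origin_def terminus_def)

lemma edge_path_subgraph:
  assumes "subgraph G H" "edge_path G u p w"
  shows "edge_path H u p w"
  using assms(2)
proof (induction p arbitrary: u)
  case Nil
  then show ?case using assms(1) by (auto simp: subgraph_def)
next
  case (Cons x p)
  then show ?case using assms(1) subgraph_ends[OF assms(1)] by (auto simp: subgraph_def)
qed

lemma closed_paths_subgraph: "subgraph G H \<Longrightarrow> closed_paths G v \<subseteq> closed_paths H v"
  unfolding closed_paths_def by (rule Collect_mono) (rule impI, erule (1) edge_path_subgraph)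

lemma edge_path_arcs: "edge_path G u p w \<Longrightarrow> fst ` set p \<subseteq> arcs G"
proof (induction p arbitrary: u)
  case (Cons x p)
  then show ?case using Cons.IH[of "terminus G x"] by simp
qed simp

lemma edge_path_in_subgraph:
  assumes "subgraph G H" "edge_path H u p w" "fst ` set p \<subseteq> arcs G" "u \<in> verts G"
  shows "edge_path G u p w"
  using assms(2-)
proof (induction p arbitrary: u)
  case (Cons x p)
  have G: "wf_digraph G" using assms(1) by (simp add: subgraph_def)
  have x: "fst x \<in> arcs G" "origin H x = u" "edge_path H (terminus H x) p w"
    "fst ` set p \<subseteq> arcs G"
    using Cons.prems by simp_all
  have "terminus G x \<in> verts G"
    using wf_digraph.head_in_verts[OF G x(1)] wf_digraph.tail_in_verts[OF G x(1)]
    by (simp add: terminus_def)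
  then show ?case
    using Cons.IH[of "terminus H x"] x by (simp add: subgraph_ends[OF assms(1)])
qed simp

lemma graph_map_subgraph:
  assumes "graph_map H B fv fe" "subgraph G H"
  shows "graph_map G B fv fe"
  using assms by (auto simp: graph_map_def subgraph_def compatible_def)

theorem theorem1p2:
  fixes B :: "('w, 'd) pre_digraph" and b :: 'w
    and J :: "('v, 'e) pre_digraph" and v :: 'v
    and fv :: "'v \<Rightarrow> 'w" and fe :: "'e \<Rightarrow> 'd"
    and Js :: "nat \<Rightarrow> ('v, 'e) pre_digraph"
  assumes "bouquet B b"
    and "v \<in> verts J"
    and "immersion J B fv fe"
    and "\<And>i. subgraph (Js i) J"
    and "\<And>i. fin_digraph (Js i)"
    and "\<And>i. Digraph_Component.connected (Js i)"
    and "\<And>i. v \<in> verts (Js i)"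
    and "\<And>i. subgraph (Js i) (Js (Suc i))"
    and "verts J = (\<Union>i. verts (Js i))"
    and "arcs J = (\<Union>i. arcs (Js i))"
  shows "(\<lambda>i. growth_rate (fundamental_group B b) (loop_basis B b)
                 (pi1_image (Js i) v B b fe))
           \<longlonglongrightarrow> growth_rate (fundamental_group B b) (loop_basis B b)
                 (pi1_image J v B b fe)"
proof -
  have J: "graph_map J B fv fe" using assms(3) by (simp add: immersion_def)
  have Js: "graph_map (Js i) B fv fe" for i by (rule graph_map_subgraph[OF J assms(4)])
  have wf: "wf_digraph J" "wf_digraph (Js i)" for i
    using assms(4)[of i] by (simp_all add: subgraph_def)
  have "incseq (\<lambda>i. closed_paths (Js i) v)"
    by (simp add: incseq_Suc_iff closed_paths_subgraph assms(8))
  then have inc: "incseq (\<lambda>i. image_words (Js i) v fe)"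
    by (simp add: incseq_def image_words_def image_mono)
  have arcs: "incseq (\<lambda>i. arcs (Js i))"
    using assms(8) by (simp add: incseq_Suc_iff subgraph_def)
  have "closed_paths J v = (\<Union>i. closed_paths (Js i) v)"
  proof (intro equalityI subsetI)
    fix p assume "p \<in> closed_paths J v"
    then have p: "edge_path J v p v" by (simp add: closed_paths_def)
    \<comment> \<open>A path has only finitely many edges, so a single \<open>Js i\<close> contains
      them all.\<close>
    have "fst ` set p \<subseteq> (\<Union>i. arcs (Js i))" using edge_path_arcs[OF p] unfolding assms(10) .
    then obtain i where "fst ` set p \<subseteq> arcs (Js i)"
      using finite_subset_incseq[OF _ _ arcs] finite_imageI[OF finite_set] by metis
    then have "edge_path (Js i) v p v" by (rule edge_path_in_subgraph[OF assms(4) p _ assms(7)])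
    then show "p \<in> (\<Union>i. closed_paths (Js i) v)" by (auto simp: closed_paths_def)
  next
    fix p assume "p \<in> (\<Union>i. closed_paths (Js i) v)"
    then show "p \<in> closed_paths J v" using closed_paths_subgraph[OF assms(4)] by blast
  qed
  then have U: "image_words J v fe = (\<Union>i. image_words (Js i) v fe)"
    by (simp add: image_words_def image_UN)
  have "finite (arcs B)"
    using assms(1) by (simp add: bouquet_def fin_digraph_def fin_digraph_axioms_def)
  \<comment> \<open>The oriented edges of \<open>B\<close> form the finite alphabet common to all
    these groups.\<close>
  then have fin: "finite (arcs B \<times> (UNIV :: bool set))" by simp
  have S: "set p \<subseteq> arcs B \<times> UNIV" if "p \<in> image_words (Js i) v fe" for i p
  proof -
    have "p \<in> closed_paths B b" using that image_words_closed[OF assms(1) Js assms(7)] by blast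
    then have "fst ` set p \<subseteq> arcs B" unfolding bouquet_closed_paths[OF assms(1)] .
    then show ?thesis by (simp add: image_subset_iff mem_Times_iff subset_iff)
  qed
  have "(\<lambda>i. growth (image_words (Js i) v fe)) \<longlonglongrightarrow> growth (\<Union>i. image_words (Js i) v fe)"
  proof (rule growth_union[OF _ fin S inc])
    show "word_group (image_words (Js i) v fe)" for i
      by (rule word_group_image_words[OF wf(2) assms(7)])
    show "word_group (\<Union>i. image_words (Js i) v fe)"
      using word_group_image_words[OF wf(1) assms(2), of fe] unfolding U .
  qed
  then show ?thesis
    unfolding growth_rate_eq_growth[OF assms(1) Js assms(7)]
      growth_rate_eq_growth[OF assms(1) J assms(2)] U .
qed

end
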